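(* Let $(X,T)$ be a topological dynamical system, where $X$ is a non-empty compact metric space with metric $d$ and $T:X\to X$ is continuous, and let $\mu\in M(X,T)$. Then the following statements are equivalent: (1) $\mu$ is ergodic; (2) $(\mu\times\mu)\big(N(F)\big)=1$; (3) $(\mu\times\mu)\big(N(\underline F)\big)=1$.
   Context: $M(X,T)$ is the set of all $T$-invariant regular Borel probability measures on $X$. $S_n$ denotes the group of permutations of $\{1,\dots,n\}$. For $x,y\in X$ define $\overline F(x,y)=\limsup_{n\to+\infty}\inf_{\sigma\in S_n}\frac1n\sum_{k=1}^n d(T^kx,T^{\sigma(k)}y)$ and $\underline F(x,y)=\liminf_{n\to+\infty}\inf_{\sigma\in S_n}\frac1n\sum_{k=1}^n d(T^kx,T^{\sigma(k)}y)$. If $\overline F(x,y)=\underline F(x,y)$, we say $F(x,y)$ exists and denote the common value by $F(x,y)$. $N(F)=\{(x,y)\in X\times X : F(x,y)\text{ exists and } F(x,y)=0\}$ and $N(\underline F)=\{(x,y)\in X\times X:\underline F(x,y)=0\}$. *)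

theory Defs
  imports "HOL-Probability.Probability"
begin

(* The phase space is a subset X of a metric type with the induced metric dist; T is only
   relevant on X. Measures on X live on the trace of the Borel sigma-algebra, which is the
   Borel sigma-algebra of the subspace X. *)

definition regular_measure :: "'a::metric_space set \<Rightarrow> 'a measure \<Rightarrow> bool" where
  "regular_measure X \<mu> \<longleftrightarrow>
     (\<forall>A\<in>sets \<mu>.
        emeasure \<mu> A = (INF U\<in>{U. openin (top_of_set X) U \<and> A \<subseteq> U}. emeasure \<mu> U) \<and>
        emeasure \<mu> A = (SUP K\<in>{K. compact K \<and> K \<subseteq> A}. emeasure \<mu> K))"

definition invariant_measures :: "'a::metric_space set \<Rightarrow> ('a \<Rightarrow> 'a) \<Rightarrow> 'a measure set" where
  "invariant_measures X T =
     {\<mu>. prob_space \<mu> \<and> sets \<mu> = sets (restrict_space borel X) \<and> regular_measure X \<mu> \<and>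
          (\<forall>A\<in>sets \<mu>. emeasure \<mu> (T -` A \<inter> space \<mu>) = emeasure \<mu> A)}"

definition ergodic :: "('a \<Rightarrow> 'a) \<Rightarrow> 'a measure \<Rightarrow> bool" where
  "ergodic T \<mu> \<longleftrightarrow>
     (\<forall>A\<in>sets \<mu>. T -` A \<inter> space \<mu> = A \<longrightarrow> emeasure \<mu> A = 0 \<or> emeasure \<mu> A = 1)"

(* The infimum is over the finite nonempty set of permutations of {1..n}, so the real-valued
   INF is the genuine minimum. *)
definition F_finite :: "('a::metric_space \<Rightarrow> 'a) \<Rightarrow> nat \<Rightarrow> 'a \<Rightarrow> 'a \<Rightarrow> real" where
  "F_finite T n x y =
     (INF \<sigma>\<in>{\<sigma>. \<sigma> permutes {1..n}}.
        1 / real n * (\<Sum>k=1..n. dist ((T ^^ k) x) ((T ^^ \<sigma> k) y)))"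

(* Upper and lower limits are taken in the extended reals, where they always exist. *)
definition F_upper :: "('a::metric_space \<Rightarrow> 'a) \<Rightarrow> 'a \<Rightarrow> 'a \<Rightarrow> ereal" where
  "F_upper T x y = limsup (\<lambda>n. ereal (F_finite T n x y))"

definition F_lower :: "('a::metric_space \<Rightarrow> 'a) \<Rightarrow> 'a \<Rightarrow> 'a \<Rightarrow> ereal" where
  "F_lower T x y = liminf (\<lambda>n. ereal (F_finite T n x y))"

definition F_exists :: "('a::metric_space \<Rightarrow> 'a) \<Rightarrow> 'a \<Rightarrow> 'a \<Rightarrow> bool" where
  "F_exists T x y \<longleftrightarrow> F_upper T x y = F_lower T x y"

(* Meaningful only where F_exists holds; it is then the common value. *)
definition F_value :: "('a::metric_space \<Rightarrow> 'a) \<Rightarrow> 'a \<Rightarrow> 'a \<Rightarrow> ereal" where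
  "F_value T x y = F_upper T x y"

definition N_F :: "'a::metric_space set \<Rightarrow> ('a \<Rightarrow> 'a) \<Rightarrow> ('a \<times> 'a) set" where
  "N_F X T = {(x, y). x \<in> X \<and> y \<in> X \<and> F_exists T x y \<and> F_value T x y = 0}"

definition N_F_lower :: "'a::metric_space set \<Rightarrow> ('a \<Rightarrow> 'a) \<Rightarrow> ('a \<times> 'a) set" where
  "N_F_lower X T = {(x, y). x \<in> X \<and> y \<in> X \<and> F_lower T x y = 0}"

end

theory Submission
  imports Defs
begin

text \<open>If \<mu> is ergodic, almost every point visits each cell of a finite partition into small sets with
  the same asymptotic frequency; so for almost every pair the two orbit segments of length n can be
  matched by a permutation with only o(n) indices falling in different cells, whence F = 0.
  Conversely, suppose A and B = X - A are invariant with positive measure. A Lipschitz function f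
  that is close to the indicator of a compact subset of A has a larger mean on A than on B. By the
  maximal ergodic lemma there are a set of positive measure in B on which all averages of f are at
  most c and a set of positive measure in A on which all of them are at least some c' > c. As a
  matching can change averages of f by at most its Lipschitz constant times the matching cost, the
  lower limit is positive on the product of these two sets.\<close>

section \<open>Orbit sums and their maximal functions\<close>

definition orbit_sum :: "('a \<Rightarrow> 'a) \<Rightarrow> ('a \<Rightarrow> real) \<Rightarrow> nat \<Rightarrow> 'a \<Rightarrow> real" where
  "orbit_sum T f n x = (\<Sum>k=1..n. f ((T ^^ k) x))"

lemma orbit_sum_0 [simp]: "orbit_sum T f 0 x = 0"
  by (simp add: orbit_sum_def)

lemma orbit_sum_Suc: "orbit_sum T f (Suc n) x = f (T x) + orbit_sum T f n (T x)"
proof -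
  have "orbit_sum T f (Suc n) x = f (T x) + (\<Sum>k=Suc 1..Suc n. f ((T ^^ k) x))"
    unfolding orbit_sum_def by (subst sum.atLeast_Suc_atMost) auto
  also have "(\<Sum>k=Suc 1..Suc n. f ((T ^^ k) x)) = orbit_sum T f n (T x)"
    unfolding orbit_sum_def by (subst sum.shift_bounds_cl_Suc_ivl) (simp add: funpow_swap1)
  finally show ?thesis .
qed

lemma orbit_sum_minus: "orbit_sum T (\<lambda>x. - f x) n x = - orbit_sum T f n x"
  by (simp add: orbit_sum_def sum_negf)

lemma orbit_sum_diff_const: "orbit_sum T (\<lambda>x. f x - c) n x = orbit_sum T f n x - real n * c"
  by (simp add: orbit_sum_def sum_subtractf)

text \<open>This is the maximum of \<open>orbit_sum T g k x\<close> over 0 <= k <= n. Defining it by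
  recursion along the orbit builds in the identity on which Garsia's argument rests.\<close>

primrec max_orbit_sum :: "('a \<Rightarrow> 'a) \<Rightarrow> ('a \<Rightarrow> real) \<Rightarrow> nat \<Rightarrow> 'a \<Rightarrow> real" where
  "max_orbit_sum T g 0 = (\<lambda>x. 0)"
| "max_orbit_sum T g (Suc n) = (\<lambda>x. max 0 (g (T x) + max_orbit_sum T g n (T x)))"

lemma max_orbit_sum_nonneg: "0 \<le> max_orbit_sum T g n x"
  by (cases n) auto

lemma max_orbit_sum_mono: "max_orbit_sum T g n x \<le> max_orbit_sum T g (Suc n) x"
proof (induction n arbitrary: x)
  case (Suc n)
  have "max 0 (g (T x) + max_orbit_sum T g n (T x)) \<le>
      max 0 (g (T x) + max_orbit_sum T g (Suc n) (T x))"
    by (intro max.mono add_left_mono order_refl Suc)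
  then show ?case by (simp only: max_orbit_sum.simps)
qed simp

lemma orbit_sum_le_max_orbit_sum: "orbit_sum T g n x \<le> max_orbit_sum T g n x"
proof (induction n arbitrary: x)
  case (Suc n)
  show ?case
    using Suc[of "T x"] by (simp add: orbit_sum_Suc)
qed simp

section \<open>Maximal ergodic lemma and pointwise ergodic theorem\<close>

locale measure_preserving_system = prob_space M for M :: "'a measure" +
  fixes T :: "'a \<Rightarrow> 'a"
  assumes T_measurable [measurable]: "T \<in> M \<rightarrow>\<^sub>M M"
    and distr_T: "distr M M T = M"
begin

lemma T_in_space: "x \<in> space M \<Longrightarrow> T x \<in> space M"
  using measurable_space[OF T_measurable] .

lemma funpow_measurable [measurable]: "(T ^^ k) \<in> M \<rightarrow>\<^sub>M M"
  by (induction k) (auto intro: measurable_comp)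

lemma orbit_sum_measurable [measurable]:
  assumes [measurable]: "f \<in> borel_measurable M"
  shows "orbit_sum T f n \<in> borel_measurable M"
  unfolding orbit_sum_def[abs_def] by measurable

lemma integral_T:
  assumes "f \<in> borel_measurable M"
  shows "(\<integral>x. f (T x) \<partial>M) = (\<integral>x. (f x :: real) \<partial>M)"
  using integral_distr[OF T_measurable, of f] assms by (simp add: distr_T)

lemma integrable_bounded:
  assumes "f \<in> borel_measurable M" "\<And>x. x \<in> space M \<Longrightarrow> \<bar>f x\<bar> \<le> (b::real)"
  shows "integrable M f"
  by (rule integrable_const_bound[of f b]) (use assms in auto)

lemma max_orbit_sum_measurable [measurable]:
  assumes [measurable]: "g \<in> borel_measurable M"
  shows "max_orbit_sum T g n \<in> borel_measurable M"
  by (induction n) auto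

lemma max_orbit_sum_le:
  assumes "\<And>x. x \<in> space M \<Longrightarrow> \<bar>g x\<bar> \<le> b" "x \<in> space M"
  shows "max_orbit_sum T g n x \<le> real n * b"
  using assms(2)
proof (induction n arbitrary: x)
  case (Suc n)
  have "\<bar>g (T x)\<bar> \<le> b" "max_orbit_sum T g n (T x) \<le> real n * b"
    using Suc assms(1) T_in_space by auto
  moreover have "0 \<le> max_orbit_sum T g n (T x)" "0 \<le> b"
    using max_orbit_sum_nonneg calculation(1) by auto
  ultimately show ?case by (auto simp: algebra_simps)
qed simp

text \<open>Garsia's argument: where the maximal function of order n + 1 is positive, it equals g \<circ> T
  plus the maximal function of order n composed with T.\<close>

lemma integral_pos_max_nonneg:
  assumes [measurable]: "g \<in> borel_measurable M"
    and b: "\<And>x. x \<in> space M \<Longrightarrow> \<bar>g x\<bar> \<le> b"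
  shows "0 \<le> (\<integral>x. indicator {x. 0 < max_orbit_sum T g (Suc n) x} x * g (T x) \<partial>M)"
proof -
  let ?m = "max_orbit_sum T g"
  have int: "integrable M (?m k)" for k
    by (rule integrable_bounded[of _ "real k * b"])
       (use max_orbit_sum_le[of g b] b in \<open>auto simp: max_orbit_sum_nonneg\<close>)
  have intT: "integrable M (\<lambda>x. ?m k (T x))" for k
    by (rule integrable_bounded[of _ "real k * b"])
       (use max_orbit_sum_le[of g b] b in \<open>auto simp: max_orbit_sum_nonneg T_in_space\<close>)
  have "0 \<le> (\<integral>x. ?m (Suc n) x \<partial>M) - (\<integral>x. ?m n x \<partial>M)"
    using integral_mono[OF int int, of n "Suc n"] max_orbit_sum_mono[of T g n] by simp
  also have "\<dots> = (\<integral>x. ?m (Suc n) x \<partial>M) - (\<integral>x. ?m n (T x) \<partial>M)"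
    using integral_T[of "?m n"] by simp
  also have "\<dots> = (\<integral>x. ?m (Suc n) x - ?m n (T x) \<partial>M)"
    by (rule Bochner_Integration.integral_diff[symmetric]) (rule int intT)+
  also have "\<dots> \<le> (\<integral>x. indicator {x. 0 < ?m (Suc n) x} x * g (T x) \<partial>M)"
  proof (rule integral_mono)
    show "integrable M (\<lambda>x. ?m (Suc n) x - ?m n (T x))"
      by (intro Bochner_Integration.integrable_diff int intT)
    show "integrable M (\<lambda>x. indicator {x. 0 < ?m (Suc n) x} x * g (T x))"
    proof (rule integrable_bounded[of _ b])
      fix x assume "x \<in> space M"
      then show "\<bar>indicator {x. 0 < ?m (Suc n) x} x * g (T x)\<bar> \<le> b"
        using b[of "T x"] T_in_space[of x] by (auto simp: indicator_def)
    qed (unfold indicator_def, measurable)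
  next
    fix x
    \<comment> \<open>Where the maximal function on the left is positive, both sides agree;
      elsewhere it is 0, and the left side is at most 0 because \<open>?m n\<close> is
      nonnegative.\<close>
    show "?m (Suc n) x - ?m n (T x) \<le> indicator {x. 0 < ?m (Suc n) x} x * g (T x)"
      using max_orbit_sum_nonneg[of T g n "T x"] by (auto simp: indicator_def max_def)
  qed
  finally show ?thesis .
qed

text \<open>Garsia's inequality is applied to f cut off outside A. By invariance the cut-off
  function has the orbit sums of f on A and vanishes along orbits outside A. By \<open>pos\<close>
  the sets where its maximal functions are positive exhaust A up to a null set, and dominated
  convergence passes to the limit.\<close>

lemma maximal_ergodic_lemma:
  assumes f [measurable]: "f \<in> borel_measurable M"
    and b: "\<And>x. x \<in> space M \<Longrightarrow> \<bar>f x\<bar> \<le> b"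
    and A [measurable]: "A \<in> sets M" and inv: "T -` A \<inter> space M = A"
    and pos: "AE x in M. x \<in> A \<longrightarrow> (\<exists>n. 0 < orbit_sum T f n x)"
  shows "0 \<le> (\<integral>x. indicator A x * f x \<partial>M)"
proof -
  define g where "g = (\<lambda>x. indicator A x * f x)"
  have [measurable]: "g \<in> borel_measurable M" unfolding g_def by measurable
  have TA: "T x \<in> A \<longleftrightarrow> x \<in> A" if "x \<in> space M" for x
    using inv that by auto
  have gb: "\<bar>g x\<bar> \<le> b" if "x \<in> space M" for x
    using b[OF that] by (auto simp: g_def indicator_def)
  have sum_g: "orbit_sum T g n x = orbit_sum T f n x" if "x \<in> A" for n x
    using that
  proof (induction n arbitrary: x)
    case (Suc n)
    have "x \<in> space M" using Suc.prems sets.sets_into_space[OF A] by auto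
    then have "T x \<in> A" using Suc.prems TA by auto
    then show ?case using Suc.IH by (simp add: orbit_sum_Suc g_def)
  qed simp
  let ?h = "\<lambda>n x. indicator {x. 0 < max_orbit_sum T g (Suc n) x} x * g (T x)"
  have lim: "(\<lambda>n. \<integral>x. ?h n x \<partial>M) \<longlonglongrightarrow> (\<integral>x. g (T x) \<partial>M)"
  proof (rule integral_dominated_convergence[where w = "\<lambda>_. b"])
    show "AE x in M. (\<lambda>n. ?h n x) \<longlonglongrightarrow> g (T x)"
      using pos AE_space
    proof eventually_elim
      case (elim x)
      show ?case
      proof (cases "x \<in> A")
        case True
        then obtain n where "0 < orbit_sum T f n x" using elim by auto
        then have n: "0 < max_orbit_sum T g n x"
          using sum_g[OF True] orbit_sum_le_max_orbit_sum[of T g n x] by auto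
        have "?h k x = g (T x)" if "k \<ge> n" for k
        proof -
          have "max_orbit_sum T g n x \<le> max_orbit_sum T g (Suc k) x"
            using lift_Suc_mono_le[of "\<lambda>n. max_orbit_sum T g n x" n "Suc k"]
              max_orbit_sum_mono[of T g _ x] that by simp
          then show ?thesis using n by simp
        qed
        then show ?thesis
          by (intro tendsto_eventually eventually_sequentiallyI)
      next
        case False
        then have "g (T x) = 0" using elim TA by (simp add: g_def)
        then show ?thesis by simp
      qed
    qed
    show "AE x in M. norm (?h n x) \<le> b" for n
    proof (rule AE_I2)
      fix x assume "x \<in> space M"
      then show "norm (?h n x) \<le> b"
        using gb[of "T x"] T_in_space[of x] by (auto simp: indicator_def)
    qed
    show "?h n \<in> borel_measurable M" for n
      unfolding indicator_def by measurable
  qed auto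
  have "0 \<le> (\<integral>x. g (T x) \<partial>M)"
    by (rule LIMSEQ_le_const[OF lim]) (use integral_pos_max_nonneg[of g b] gb in auto)
  also have "\<dots> = (\<integral>x. g x \<partial>M)" by (rule integral_T) measurable
  finally show ?thesis by (simp add: g_def)
qed

text \<open>This is the previous lemma for f - c. Its contrapositive finds, in an invariant set
  where f has mean below c, a non-null part on which every average is at most c.\<close>

lemma maximal_ergodic_lemma_const:
  assumes f [measurable]: "f \<in> borel_measurable M"
    and b: "\<And>x. x \<in> space M \<Longrightarrow> \<bar>f x\<bar> \<le> b"
    and A [measurable]: "A \<in> sets M" and inv: "T -` A \<inter> space M = A"
    and pos: "AE x in M. x \<in> A \<longrightarrow> (\<exists>n. real n * c < orbit_sum T f n x)"
  shows "c * measure M A \<le> (\<integral>x. indicator A x * f x \<partial>M)"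
proof -
  have "0 \<le> (\<integral>x. indicator A x * (f x - c) \<partial>M)"
  proof (rule maximal_ergodic_lemma)
    show "\<bar>f x - c\<bar> \<le> b + \<bar>c\<bar>" if "x \<in> space M" for x
      using b[OF that] by linarith
  qed (use pos inv in \<open>auto simp: orbit_sum_diff_const\<close>)
  also have "\<dots> = (\<integral>x. indicator A x * f x - c * indicator A x \<partial>M)"
    by (simp add: algebra_simps)
  also have "\<dots> = (\<integral>x. indicator A x * f x \<partial>M) - (\<integral>x. c * indicator A x \<partial>M)"
  proof (rule Bochner_Integration.integral_diff)
    show "integrable M (\<lambda>x. indicator A x * f x)"
    proof (rule integrable_bounded[of _ b])
      fix x assume "x \<in> space M"
      then show "\<bar>indicator A x * f x\<bar> \<le> b" using b[of x] by (auto simp: indicator_def)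
    qed measurable
    show "integrable M (\<lambda>x. c * indicator A x)"
      by (rule integrable_bounded[of _ "\<bar>c\<bar>"]) (auto simp: indicator_def)
  qed
  finally show ?thesis using A by (simp add: sets.sets_into_space Int_absorb2)
qed

text \<open>Unboundedness of the normalised sums, unlike positivity of the limes superior of the
  averages, is an exactly invariant condition.\<close>

lemma ergodic_orbit_sum_upper_bound:
  assumes f [measurable]: "f \<in> borel_measurable M"
    and b: "\<And>x. x \<in> space M \<Longrightarrow> \<bar>f x\<bar> \<le> b"
    and erg: "ergodic T M" and c: "(\<integral>x. f x \<partial>M) < c"
  shows "AE x in M. \<exists>K::nat. \<forall>n. orbit_sum T f n x \<le> real n * c + real K"
proof -
  define A where "A = {x \<in> space M. \<forall>K::nat. \<exists>n. real n * c + real K < orbit_sum T f n x}"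
  have A [measurable]: "A \<in> sets M" unfolding A_def by measurable
  have inv: "T -` A \<inter> space M = A"
  proof (intro set_eqI iffI)
    fix x assume x: "x \<in> T -` A \<inter> space M"
    have "\<exists>n. real n * c + real K < orbit_sum T f n x" for K
    proof -
      \<comment> \<open>K' absorbs the term f (T x) and the change of n * c by c when the orbit is
        shifted by one step.\<close>
      obtain K' :: nat where K': "real K + \<bar>c\<bar> + \<bar>f (T x)\<bar> \<le> real K'" by (meson real_arch_simple)
      obtain n where "real n * c + real K' < orbit_sum T f n (T x)" using x by (auto simp: A_def)
      then have "real (Suc n) * c + real K < orbit_sum T f (Suc n) x"
        using K' unfolding orbit_sum_Suc by (simp add: algebra_simps)
      then show ?thesis by blast
    qed
    then show "x \<in> A" using x by (simp add: A_def)
  next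
    fix x assume x: "x \<in> A"
    have "\<exists>n. real n * c + real K < orbit_sum T f n (T x)" for K
    proof -
      obtain K' :: nat where K': "real K + \<bar>c\<bar> + \<bar>f (T x)\<bar> \<le> real K'" by (meson real_arch_simple)
      obtain n where n: "real n * c + real K' < orbit_sum T f n x" using x by (auto simp: A_def)
      \<comment> \<open>The case n = 0 is impossible: the empty orbit sum is 0 and cannot exceed K',
        which is nonnegative.\<close>
      then obtain m where m: "n = Suc m" by (cases n) auto
      have "real m * c + real K < orbit_sum T f m (T x)"
        using K' n unfolding m orbit_sum_Suc by (simp add: algebra_simps)
      then show ?thesis by blast
    qed
    then show "x \<in> T -` A \<inter> space M" using x T_in_space by (simp add: A_def)
  qed
  \<comment> \<open>On a set A of full measure the maximal lemma, fed with the case K = 0 of the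
    condition defining A, would make the integral of f at least c.\<close>
  have "emeasure M A \<noteq> 1"
  proof
    assume 1: "emeasure M A = 1"
    then have "prob A = 1" by (simp add: measure_def)
    then have ae: "AE x in M. x \<in> A" by (simp add: prob_eq_1)
    have "c * measure M A \<le> (\<integral>x. indicator A x * f x \<partial>M)"
    proof (rule maximal_ergodic_lemma_const[OF f b A inv])
      show "AE x in M. x \<in> A \<longrightarrow> (\<exists>n. real n * c < orbit_sum T f n x)"
        by (rule AE_I2) (auto simp: A_def dest!: spec[of _ 0])
    qed
    also have "(\<integral>x. indicator A x * f x \<partial>M) = (\<integral>x. f x \<partial>M)"
      by (rule integral_cong_AE) (use ae in auto)
    finally show False using c \<open>prob A = 1\<close> by simp
  qed
  moreover have "emeasure M A = 0 \<or> emeasure M A = 1"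
    using erg[unfolded ergodic_def, rule_format, OF A inv] .
  ultimately have "emeasure M A = 0" by blast
  then have "A \<in> null_sets M" using A by blast
  then have "AE x in M. x \<notin> A" by (rule AE_not_in)
  then show ?thesis using AE_space
    by eventually_elim (simp add: A_def not_less)
qed

text \<open>Upper bounds for f and for -f with slack 1 / (j + 1) trap the averages around the
  integral, as the additive constants vanish after division by n. Taking only countably many slacks
  keeps the exceptional set null.\<close>

theorem ergodic_average_tendsto:
  assumes f [measurable]: "f \<in> borel_measurable M"
    and b: "\<And>x. x \<in> space M \<Longrightarrow> \<bar>f x\<bar> \<le> b"
    and erg: "ergodic T M"
  shows "AE x in M. (\<lambda>n. orbit_sum T f n x / real n) \<longlonglongrightarrow> (\<integral>x. f x \<partial>M)"
proof -
  let ?I = "\<integral>x. f x \<partial>M"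
  have "AE x in M. \<forall>j. \<exists>K::nat. \<forall>n. orbit_sum T f n x \<le> real n * (?I + 1 / real (Suc j)) + real K"
    unfolding AE_all_countable
    by (intro allI ergodic_orbit_sum_upper_bound[OF f b erg]) auto
  moreover have "AE x in M. \<forall>j. \<exists>K::nat. \<forall>n. orbit_sum T (\<lambda>x. - f x) n x
      \<le> real n * (- ?I + 1 / real (Suc j)) + real K"
    unfolding AE_all_countable
    by (intro allI ergodic_orbit_sum_upper_bound[OF _ _ erg]) (use b in auto)
  ultimately show ?thesis
  proof eventually_elim
    case (elim x)
    show ?case
    proof (rule LIMSEQ_I)
      fix r :: real assume "0 < r"
      then obtain j where j: "1 / real (Suc j) < r / 2"
        using nat_approx_posE[of "r / 2"] by auto
      obtain K L :: nat
        where K: "\<And>n. orbit_sum T f n x \<le> real n * (?I + 1 / real (Suc j)) + real K"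
          and L: "\<And>n. - orbit_sum T f n x \<le> real n * (- ?I + 1 / real (Suc j)) + real L"
        using elim unfolding orbit_sum_minus by metis
      \<comment> \<open>For n > N the constants K + L stay below n * r / 2; the slack j contributes
        less than n * r / 2 as well.\<close>
      obtain N :: nat where N: "2 * (real K + real L) / r < real N"
        using reals_Archimedean2 by blast
      have "norm (orbit_sum T f n x / real n - ?I) < r" if n: "n \<ge> Suc N" for n
      proof -
        have n0: "0 < real n" using n by simp
        have "2 * (real K + real L) / r < real n" using N n by simp
        then have KL: "real K + real L < real n * (r / 2)"
          using \<open>0 < r\<close> by (simp add: field_simps)
        have d: "real n * (1 / real (Suc j)) \<le> real n * (r / 2)"
          using j by (intro mult_left_mono) auto
        have "orbit_sum T f n x - real n * ?I < real n * r"
          using K[of n] KL d unfolding distrib_left by linarith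
        moreover have "- (orbit_sum T f n x - real n * ?I) < real n * r"
          using L[of n] KL d unfolding distrib_left mult_minus_right by linarith
        ultimately have "\<bar>orbit_sum T f n x - real n * ?I\<bar> < real n * r" by linarith
        moreover have "orbit_sum T f n x / real n - ?I = (orbit_sum T f n x - real n * ?I) / real n"
          using n0 by (simp add: field_simps)
        ultimately show ?thesis using n0 by (simp add: field_simps)
      qed
      then show "\<exists>no. \<forall>n\<ge>no. norm (orbit_sum T f n x / real n - ?I) < r" by blast
    qed
  qed
qed

end

section \<open>Matching labelled finite sets\<close>

text \<open>Elements with equal labels are paired off greedily: removing such a pair lowers both
  counts of its label by one and leaves every difference unchanged. Once no label is common to both
  sides, all pairs are mismatches, but then each difference is at least the count in A, and these
  counts add up to \<open>card A\<close>.\<close>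

lemma exists_bij_few_mismatches:
  fixes a :: "'a \<Rightarrow> nat" and b :: "'b \<Rightarrow> nat"
  assumes "finite A" "finite B" "card A = card B" "a ` A \<subseteq> {..<m}"
  shows "\<exists>s. bij_betw s A B \<and>
    real (card {k\<in>A. a k \<noteq> b (s k)}) \<le>
      (\<Sum>i<m. \<bar>real (card {k\<in>A. a k = i}) - real (card {k\<in>B. b k = i})\<bar>)"
  using assms
proof (induction "card A" arbitrary: A B)
  case 0
  then show ?case by (auto simp: bij_betw_def)
next
  case (Suc n)
  note fin = \<open>finite A\<close> \<open>finite B\<close>
  show ?case
  proof (cases "\<exists>x\<in>A. \<exists>y\<in>B. a x = b y")
    case True
    then obtain x y where xy: "x \<in> A" "y \<in> B" "a x = b y" by blast
    have "\<exists>s. bij_betw s (A - {x}) (B - {y}) \<and>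
      real (card {k\<in>A - {x}. a k \<noteq> b (s k)}) \<le>
      (\<Sum>i<m. \<bar>real (card {k\<in>A - {x}. a k = i}) - real (card {k\<in>B - {y}. b k = i})\<bar>)"
      using Suc xy by (intro Suc.hyps) auto
    then obtain s where s: "bij_betw s (A - {x}) (B - {y})"
      and le: "real (card {k\<in>A - {x}. a k \<noteq> b (s k)}) \<le>
        (\<Sum>i<m. \<bar>real (card {k\<in>A - {x}. a k = i}) - real (card {k\<in>B - {y}. b k = i})\<bar>)"
      by blast
    define t where "t = s(x := y)"
    have "bij_betw t (A - {x}) (B - {y})"
      using s by (rule bij_betw_cong[THEN iffD1, rotated]) (auto simp: t_def)
    then have "bij_betw t (insert x (A - {x})) (insert y (B - {y}))"
      using notIn_Un_bij_betw[of x "A - {x}" t "B - {y}"] by (simp add: t_def)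
    then have t: "bij_betw t A B" using xy by (simp add: insert_absorb)
    have mis: "{k\<in>A. a k \<noteq> b (t k)} = {k\<in>A - {x}. a k \<noteq> b (s k)}"
      using xy by (auto simp: t_def)
    have card_eq: "\<bar>real (card {k\<in>A - {x}. a k = i}) - real (card {k\<in>B - {y}. b k = i})\<bar> =
        \<bar>real (card {k\<in>A. a k = i}) - real (card {k\<in>B. b k = i})\<bar>" for i
    proof (cases "a x = i")
      case True
      have "{k\<in>A. a k = i} = insert x {k\<in>A - {x}. a k = i}"
        "{k\<in>B. b k = i} = insert y {k\<in>B - {y}. b k = i}"
        using True xy by auto
      then show ?thesis using fin by simp
    next
      case False
      then have "{k\<in>A - {x}. a k = i} = {k\<in>A. a k = i}" "{k\<in>B - {y}. b k = i} = {k\<in>B. b k = i}"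
        using xy by auto
      then show ?thesis by simp
    qed
    show ?thesis using t le unfolding mis[symmetric] card_eq by blast
  next
    case False
    obtain s where s: "bij_betw s A B"
      using finite_same_card_bij[OF fin] Suc.prems by blast
    have "real (card {k\<in>A. a k \<noteq> b (s k)}) \<le> real (card A)"
      using fin by (simp add: card_mono)
    also have "card A = (\<Sum>i<m. card {k\<in>A. a k = i})"
    proof -
      have "A = (\<Union>i<m. {k\<in>A. a k = i})" using Suc.prems by auto
      then have "card A = card (\<Union>i<m. {k\<in>A. a k = i})" by simp
      also have "\<dots> = (\<Sum>i<m. card {k\<in>A. a k = i})"
        using fin by (intro card_UN_disjoint) auto
      finally show ?thesis .
    qed
    also have "real \<dots> \<le> (\<Sum>i<m. \<bar>real (card {k\<in>A. a k = i}) - real (card {k\<in>B. b k = i})\<bar>)"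
      unfolding of_nat_sum
    proof (rule sum_mono)
      fix i
      have "{k\<in>A. a k = i} = {} \<or> {k\<in>B. b k = i} = {}" using False by auto
      then have "card {k\<in>A. a k = i} = 0 \<or> card {k\<in>B. b k = i} = 0"
        by (metis card.empty)
      then show "real (card {k\<in>A. a k = i})
          \<le> \<bar>real (card {k\<in>A. a k = i}) - real (card {k\<in>B. b k = i})\<bar>"
        by linarith
    qed
    finally show ?thesis using s by blast
  qed
qed

lemma exists_permutation_few_mismatches:
  fixes a b :: "'a \<Rightarrow> nat"
  assumes fin: "finite A" and "a ` A \<subseteq> {..<m}"
  shows "\<exists>s. s permutes A \<and>
    real (card {k\<in>A. a k \<noteq> b (s k)}) \<le>
      (\<Sum>i<m. \<bar>real (card {k\<in>A. a k = i}) - real (card {k\<in>A. b k = i})\<bar>)"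
proof -
  obtain s where s: "bij_betw s A A" "real (card {k\<in>A. a k \<noteq> b (s k)}) \<le>
      (\<Sum>i<m. \<bar>real (card {k\<in>A. a k = i}) - real (card {k\<in>A. b k = i})\<bar>)"
    using exists_bij_few_mismatches[OF fin fin refl assms(2), of b] by blast
  define t where "t = (\<lambda>k. if k \<in> A then s k else k)"
  have "t permutes A"
    unfolding t_def using bij_imp_permutes[of "\<lambda>k. if k \<in> A then s k else k" A] s(1)
    by (simp cong: bij_betw_cong)
  moreover have "{k\<in>A. a k \<noteq> b (t k)} = {k\<in>A. a k \<noteq> b (s k)}" by (auto simp: t_def)
  ultimately show ?thesis using s(2) by (intro exI[of _ t]) simp
qed

section \<open>Bounds for \<open>F_finite\<close>\<close>

lemma finite_F_set: "finite ((\<lambda>\<sigma>. 1 / real n * (\<Sum>k=1..n. dist ((T ^^ k) x) ((T ^^ \<sigma> k) y)))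
    ` {\<sigma>. \<sigma> permutes {1..n}})"
  by (simp add: finite_permutations)

lemma F_finite_le:
  assumes "\<sigma> permutes {1..n}"
  shows "F_finite T n x y \<le> 1 / real n * (\<Sum>k=1..n. dist ((T ^^ k) x) ((T ^^ \<sigma> k) y))"
  unfolding F_finite_def
  by (rule cINF_lower[OF bdd_below_finite[OF finite_F_set]]) (use assms in simp)

lemma F_finite_geI:
  assumes "\<And>\<sigma>. \<sigma> permutes {1..n} \<Longrightarrow>
    r \<le> 1 / real n * (\<Sum>k=1..n. dist ((T ^^ k) x) ((T ^^ \<sigma> k) y))"
  shows "r \<le> F_finite T n x y"
  unfolding F_finite_def
  by (rule cINF_greatest) (use assms permutes_id in blast)+

lemma F_finite_nonneg: "0 \<le> F_finite T n x y"
  by (rule F_finite_geI) (simp add: sum_nonneg)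

text \<open>Permuting the times does not change the orbit sum of y, so for any matching the
  difference of the sums can be taken term by term and bounded by the Lipschitz condition. Thus
  separated averages of a Lipschitz function obstruct F = 0.\<close>

lemma F_finite_ge_orbit_sum_diff:
  assumes "L-lipschitz_on X f" and T: "T \<in> X \<rightarrow> X" and "x \<in> X" "y \<in> X" "0 < L"
  shows "(orbit_sum T f n y - orbit_sum T f n x) / real n \<le> L * F_finite T n x y"
proof -
  have orbit: "(T ^^ k) z \<in> X" if "z \<in> X" for k z
    using that T by (induction k) auto
  have "(orbit_sum T f n y - orbit_sum T f n x) / real n / L \<le> F_finite T n x y"
  proof (rule F_finite_geI)
    fix \<sigma> assume \<sigma>: "\<sigma> permutes {1..n}"
    have "orbit_sum T f n y = (\<Sum>k=1..n. f ((T ^^ \<sigma> k) y))"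
      unfolding orbit_sum_def by (subst sum.permute[OF \<sigma>]) (simp add: o_def)
    then have "orbit_sum T f n y - orbit_sum T f n x
        = (\<Sum>k=1..n. f ((T ^^ \<sigma> k) y) - f ((T ^^ k) x))"
      by (simp add: orbit_sum_def sum_subtractf)
    also have "\<dots> \<le> (\<Sum>k=1..n. L * dist ((T ^^ k) x) ((T ^^ \<sigma> k) y))"
    proof (rule sum_mono)
      fix k
      have "dist (f ((T ^^ k) x)) (f ((T ^^ \<sigma> k) y)) \<le> L * dist ((T ^^ k) x) ((T ^^ \<sigma> k) y)"
        using assms orbit by (intro lipschitz_onD) auto
      then show "f ((T ^^ \<sigma> k) y) - f ((T ^^ k) x) \<le> L * dist ((T ^^ k) x) ((T ^^ \<sigma> k) y)"
        by (simp add: dist_real_def)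
    qed
    also have "\<dots> = L * (\<Sum>k=1..n. dist ((T ^^ k) x) ((T ^^ \<sigma> k) y))"
      by (simp add: sum_distrib_left)
    finally have "(orbit_sum T f n y - orbit_sum T f n x) / L
        \<le> (\<Sum>k=1..n. dist ((T ^^ k) x) ((T ^^ \<sigma> k) y))"
      using \<open>0 < L\<close> by (simp add: field_simps)
    then have "(orbit_sum T f n y - orbit_sum T f n x) / L / real n
        \<le> (\<Sum>k=1..n. dist ((T ^^ k) x) ((T ^^ \<sigma> k) y)) / real n"
      by (rule divide_right_mono) simp
    then show "(orbit_sum T f n y - orbit_sum T f n x) / real n / L
        \<le> 1 / real n * (\<Sum>k=1..n. dist ((T ^^ k) x) ((T ^^ \<sigma> k) y))"
      by (simp add: mult.commute)
  qed
  then show ?thesis using \<open>0 < L\<close> by (simp only: pos_divide_le_eq mult.commute)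
qed

section \<open>Separability, measurability of the distance, small partitions\<close>

text \<open>\<open>D\<close> collects the centres of finite covers by balls of radius 1 / (n + 1).
  Centres may lie outside \<open>X\<close>, which is harmless since only distances to them
  matter.\<close>

lemma compact_countable_dense:
  fixes X :: "'a::metric_space set"
  assumes "compact X"
  obtains D where "countable D" "\<And>x e. x \<in> X \<Longrightarrow> 0 < e \<Longrightarrow> \<exists>d\<in>D. dist x d < e"
proof -
  have "\<exists>k. finite k \<and> X \<subseteq> (\<Union>x\<in>k. ball x (1 / real (Suc n)))" for n
    using assms unfolding compact_eq_totally_bounded by (metis of_nat_0_less_iff zero_less_Suc zero_less_divide_1_iff)
  then obtain k where k: "\<And>n. finite (k n)"
      "\<And>n. X \<subseteq> (\<Union>x\<in>k n. ball x (1 / real (Suc n)))"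
    by metis
  show thesis
  proof
    show "countable (\<Union>n. k n)" using k by (intro countable_UN) (auto intro: countable_finite)
    fix x e assume "x \<in> X" "0 < (e::real)"
    then obtain n where "1 / real (Suc n) < e" using nat_approx_posE by blast
    moreover obtain d where "d \<in> k n" "dist d x < 1 / real (Suc n)"
      using k(2)[of n] \<open>x \<in> X\<close> by auto
    ultimately show "\<exists>d\<in>\<Union>n. k n. dist x d < e"
      by (intro bexI[of _ d]) (auto simp: dist_commute)
  qed
qed

text \<open>The ambient type need not be second countable, so the Borel sigma-algebra of the product
  could be larger than the product sigma-algebra; separability of X repairs this.\<close>

lemma dist_measurable_pair:
  fixes X :: "'a::metric_space set"
  assumes "compact X" and sets_M: "sets M = sets (restrict_space borel X)"
  shows "(\<lambda>w. dist (fst w) (snd w)) \<in> borel_measurable (M \<Otimes>\<^sub>M M)"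
proof -
  have space_M: "space M = X" using sets_eq_imp_space_eq[OF sets_M] by (simp add: space_restrict_space)
  obtain D where D: "countable D" "\<And>x e. x \<in> X \<Longrightarrow> 0 < e \<Longrightarrow> \<exists>d\<in>D. dist x d < e"
    using compact_countable_dense[OF assms(1)] by blast
  have [measurable]: "(\<lambda>x. dist x d) \<in> borel_measurable M" for d
    unfolding measurable_cong_sets[OF sets_M refl]
    by (intro borel_measurable_continuous_on_restrict continuous_intros)
  show ?thesis
    unfolding borel_measurable_iff_less
  proof
    fix r :: real
    \<comment> \<open>Distances to a fixed d depend on one coordinate only; with d in the countable
      set \<open>D\<close> and q rational, the condition becomes a countable union of measurable
      rectangles.\<close>
    have "{w \<in> space (M \<Otimes>\<^sub>M M). dist (fst w) (snd w) < r} =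
      {w \<in> space (M \<Otimes>\<^sub>M M). \<exists>d\<in>D. \<exists>q\<in>\<rat>. dist (fst w) d < q \<and> dist (snd w) d < r - q}"
      (is "?L = ?R")
    proof (intro set_eqI iffI)
      fix w assume w: "w \<in> ?L"
      \<comment> \<open>With e half of the slack, the distance from the second point to d is below r
        - e, hence below r - q.\<close>
      define e where "e = (r - dist (fst w) (snd w)) / 2"
      have "0 < e" "fst w \<in> X" using w by (auto simp: e_def space_pair_measure space_M)
      then obtain d where d: "d \<in> D" "dist (fst w) d < e" using D by blast
      then obtain q where q: "q \<in> \<rat>" "dist (fst w) d < q" "q < e" using Rats_dense_in_real by blast
      have "dist (snd w) d \<le> dist (fst w) (snd w) + dist (fst w) d"
        by (metis dist_commute dist_triangle)
      then have "dist (snd w) d < r - q" using q d by (simp add: e_def field_simps)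
      then show "w \<in> ?R" using w d q by blast
    next
      fix w assume "w \<in> ?R"
      then obtain d q where "w \<in> space (M \<Otimes>\<^sub>M M)" "dist (fst w) d < q" "dist (snd w) d < r - q"
        by blast
      then show "w \<in> ?L" using dist_triangle2[of "fst w" "snd w" d] by simp
    qed
    also have "\<dots> \<in> sets (M \<Otimes>\<^sub>M M)"
      by (intro sets.sets_Collect_countable_Ex' D(1) countable_rat) measurable
    finally show "{w \<in> space (M \<Otimes>\<^sub>M M). dist (fst w) (snd w) < r} \<in> sets (M \<Otimes>\<^sub>M M)" .
  qed
qed

text \<open>A finite cover by balls of radius e / 2 is made disjoint by labelling a point with the
  least index of a ball containing it. Equal labels place two points in one ball, so they are less
  than e apart.\<close>

lemma compact_measurable_small_partition:
  fixes X :: "'a::metric_space set"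
  assumes "compact X" and sets_M: "sets M = sets (restrict_space borel X)" and "0 < e"
  obtains p :: "'a \<Rightarrow> nat" and m where "p \<in> M \<rightarrow>\<^sub>M count_space UNIV" "p ` X \<subseteq> {..<m}"
    "\<And>x y. x \<in> X \<Longrightarrow> y \<in> X \<Longrightarrow> p x = p y \<Longrightarrow> dist x y < e"
proof -
  obtain k where k: "finite k" "X \<subseteq> (\<Union>x\<in>k. ball x (e / 2))"
    using assms(1) \<open>0 < e\<close> unfolding compact_eq_totally_bounded by (metis half_gt_zero)
  obtain c :: "nat \<Rightarrow> 'a" and m where c: "k = c ` {i. i < m}"
    using finite_imp_nat_seg_image_inj_on[OF k(1)] by blast
  define p where "p = (\<lambda>x. LEAST i. dist (c i) x < e / 2)"
  have ex: "\<exists>i<m. dist (c i) x < e / 2" if "x \<in> X" for x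
    using subsetD[OF k(2) that] unfolding c UN_iff mem_ball by blast
  have p: "dist (c (p x)) x < e / 2" "p x < m" if "x \<in> X" for x
    using ex[OF that] LeastI[of "\<lambda>i. dist (c i) x < e / 2"] Least_le[of "\<lambda>i. dist (c i) x < e / 2"]
    by (auto simp: p_def intro: le_less_trans)
  show thesis
  proof
    have [measurable]: "(\<lambda>x. dist d x) \<in> borel_measurable M" for d
      unfolding measurable_cong_sets[OF sets_M refl]
      by (intro borel_measurable_continuous_on_restrict continuous_intros)
    show "p \<in> M \<rightarrow>\<^sub>M count_space UNIV" unfolding p_def by measurable
    show "p ` X \<subseteq> {..<m}" using p by auto
    show "dist x y < e" if "x \<in> X" "y \<in> X" "p x = p y" for x y
      using p(1)[OF that(1)] p(1)[OF that(2)] dist_triangle3[of x y "c (p x)"] that(3) by simp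
  qed
qed

text \<open>The cells label the times 1..n for both orbits, and the matching with few label
  mismatches is used. Times with equal labels cost less than e, the others at most d, and
  differences of visit counts bound the number of the latter.\<close>

lemma F_finite_le_partition:
  assumes T: "T \<in> X \<rightarrow> X" and xy: "x \<in> X" "y \<in> X" and n: "0 < n"
    and p: "(p :: 'a::metric_space \<Rightarrow> nat) ` X \<subseteq> {..<m}" "\<And>x y. x \<in> X \<Longrightarrow> y \<in> X \<Longrightarrow> p x = p y \<Longrightarrow> dist x y < e"
    and diam: "\<And>x y. x \<in> X \<Longrightarrow> y \<in> X \<Longrightarrow> dist x y \<le> d"
  shows "F_finite T n x y \<le> e + d * (\<Sum>i<m. \<bar>orbit_sum T (\<lambda>z. of_bool (p z = i)) n x / real n
    - orbit_sum T (\<lambda>z. of_bool (p z = i)) n y / real n\<bar>)"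
proof -
  have orbit: "(T ^^ k) z \<in> X" if "z \<in> X" for k z
    using that T by (induction k) auto
  have card_eq: "real (card {k\<in>{1..n}. p ((T ^^ k) z) = i}) = orbit_sum T (\<lambda>z. of_bool (p z = i)) n z"
    for z i
    by (simp add: orbit_sum_def sum_of_bool_eq Int_def)
  obtain \<sigma> where \<sigma>: "\<sigma> permutes {1..n}" and mis:
    "real (card {k\<in>{1..n}. p ((T ^^ k) x) \<noteq> p ((T ^^ \<sigma> k) y)}) \<le>
      (\<Sum>i<m. \<bar>orbit_sum T (\<lambda>z. of_bool (p z = i)) n x - orbit_sum T (\<lambda>z. of_bool (p z = i)) n y\<bar>)"
    (is "real (card ?D) \<le> ?S")
    using exists_permutation_few_mismatches[of "{1..n}" "\<lambda>k. p ((T ^^ k) x)" m "\<lambda>k. p ((T ^^ k) y)"]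
      p(1) orbit[OF xy(1)] unfolding card_eq by fastforce
  have d: "0 \<le> d" using diam[OF xy] zero_le_dist[of x y] by linarith
  \<comment> \<open>The mesh condition for x and itself shows this; it enters at mismatched times,
    where the bound is e + d.\<close>
  have e: "0 < e" using p(2)[OF xy(1) xy(1)] by simp
  have "(\<Sum>k=1..n. dist ((T ^^ k) x) ((T ^^ \<sigma> k) y)) \<le>
      (\<Sum>k=1..n. e + d * of_bool (p ((T ^^ k) x) \<noteq> p ((T ^^ \<sigma> k) y)))"
  proof (rule sum_mono)
    fix k
    show "dist ((T ^^ k) x) ((T ^^ \<sigma> k) y) \<le> e + d * of_bool (p ((T ^^ k) x) \<noteq> p ((T ^^ \<sigma> k) y))"
      using p(2)[OF orbit[OF xy(1)] orbit[OF xy(2)], of k "\<sigma> k"]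
        diam[OF orbit[OF xy(1)] orbit[OF xy(2)], of k "\<sigma> k"] e
      by (cases "p ((T ^^ k) x) = p ((T ^^ \<sigma> k) y)") auto
  qed
  also have "\<dots> = real n * e + d * real (card ?D)"
    by (simp add: sum.distrib sum_distrib_left[symmetric] sum_of_bool_eq Int_def)
  also have "\<dots> \<le> real n * e + d * ?S"
    using mis d by (intro add_left_mono mult_left_mono)
  finally have "1 / real n * (\<Sum>k=1..n. dist ((T ^^ k) x) ((T ^^ \<sigma> k) y))
      \<le> 1 / real n * (real n * e + d * ?S)"
    by (rule mult_left_mono) simp
  also have "\<dots> = e + d * (?S / real n)"
    using n by (simp add: field_simps)
  also have "?S / real n = (\<Sum>i<m. \<bar>orbit_sum T (\<lambda>z. of_bool (p z = i)) n x / real n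
    - orbit_sum T (\<lambda>z. of_bool (p z = i)) n y / real n\<bar>)"
    by (simp add: sum_divide_distrib diff_divide_distrib[symmetric])
  finally show ?thesis using F_finite_le[OF \<sigma>, of T x y] by linarith
qed

section \<open>Ergodicity and vanishing of F in compact metric systems\<close>

locale compact_metric_system = measure_preserving_system M T
  for M :: "'a::metric_space measure" and T +
  fixes X :: "'a set"
  assumes compact_X: "compact X" and sets_M: "sets M = sets (restrict_space borel X)"
begin

lemma space_M: "space M = X"
  using sets_eq_imp_space_eq[OF sets_M] by (simp add: space_restrict_space)

lemma T_in: "T \<in> X \<rightarrow> X"
  using T_in_space by (auto simp: space_M)

sublocale MM: pair_prob_space M M ..

lemma continuous_on_measurable: "continuous_on X f \<Longrightarrow> f \<in> borel_measurable M"
  unfolding measurable_cong_sets[OF sets_M refl] by (rule borel_measurable_continuous_on_restrict)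

lemma F_finite_measurable [measurable]:
  "(\<lambda>w. F_finite T n (fst w) (snd w)) \<in> borel_measurable (M \<Otimes>\<^sub>M M)"
proof -
  have [measurable]: "(\<lambda>w. dist ((T ^^ k) (fst w)) ((T ^^ j) (snd w))) \<in> borel_measurable (M \<Otimes>\<^sub>M M)"
    for k j
  proof -
    have "(\<lambda>w. ((T ^^ k) (fst w), (T ^^ j) (snd w))) \<in> (M \<Otimes>\<^sub>M M) \<rightarrow>\<^sub>M (M \<Otimes>\<^sub>M M)"
      by measurable
    from measurable_compose[OF this dist_measurable_pair[OF compact_X sets_M]] show ?thesis by simp
  qed
  show ?thesis
    unfolding F_finite_def
    by (rule borel_measurable_cINF)
      (auto intro!: countable_finite finite_permutations bdd_below_finite[OF finite_F_set[simplified]])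
qed

lemma N_F_lower_sets: "N_F_lower X T \<in> sets (M \<Otimes>\<^sub>M M)"
proof -
  have "N_F_lower X T =
    {w \<in> space (M \<Otimes>\<^sub>M M). liminf (\<lambda>n. ereal (F_finite T n (fst w) (snd w))) = 0}"
    by (auto simp: N_F_lower_def F_lower_def space_pair_measure space_M)
  also have "\<dots> \<in> sets (M \<Otimes>\<^sub>M M)" by measurable
  finally show ?thesis .
qed

lemma N_F_sets: "N_F X T \<in> sets (M \<Otimes>\<^sub>M M)"
proof -
  have "N_F X T = {w \<in> space (M \<Otimes>\<^sub>M M).
      limsup (\<lambda>n. ereal (F_finite T n (fst w) (snd w))) = liminf (\<lambda>n. ereal (F_finite T n (fst w) (snd w)))
      \<and> limsup (\<lambda>n. ereal (F_finite T n (fst w) (snd w))) = 0}"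
    by (auto simp: N_F_def F_exists_def F_value_def F_lower_def F_upper_def space_pair_measure space_M)
  also have "\<dots> \<in> sets (M \<Otimes>\<^sub>M M)" by measurable
  finally show ?thesis .
qed

lemma N_F_subset: "N_F X T \<subseteq> N_F_lower X T"
  by (auto simp: N_F_def N_F_lower_def F_exists_def F_value_def)

lemma emeasure_pair_eq_1_iff:
  "N \<in> sets (M \<Otimes>\<^sub>M M) \<Longrightarrow> emeasure (M \<Otimes>\<^sub>M M) N = 1 \<longleftrightarrow> (AE w in M \<Otimes>\<^sub>M M. w \<in> N)"
  using MM.emeasure_eq_1_AE[of N] MM.prob_eq_1[of N] by (auto simp: measure_def)

text \<open>For a partition of mesh r / 2 the bound consists of the mesh and a constant times a
  finite sum of frequency differences, and this sum tends to 0.\<close>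

lemma F_finite_tendsto_0:
  assumes xy: "x \<in> X" "y \<in> X"
    and ex: "\<And>e. 0 < e \<Longrightarrow> \<exists>(p :: 'a \<Rightarrow> nat) m. p ` X \<subseteq> {..<m} \<and>
      (\<forall>x\<in>X. \<forall>y\<in>X. p x = p y \<longrightarrow> dist x y < e) \<and>
      (\<forall>i<m. (\<lambda>n. orbit_sum T (\<lambda>z. of_bool (p z = i)) n x / real n
         - orbit_sum T (\<lambda>z. of_bool (p z = i)) n y / real n) \<longlonglongrightarrow> 0)"
  shows "(\<lambda>n. F_finite T n x y) \<longlonglongrightarrow> 0"
proof (rule LIMSEQ_I)
  fix r :: real assume "0 < r"
  obtain d where d: "\<And>x y. x \<in> X \<Longrightarrow> y \<in> X \<Longrightarrow> dist x y \<le> d"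
    using compact_imp_bounded[OF compact_X] unfolding bounded_two_points by blast
  obtain p :: "'a \<Rightarrow> nat" and m where p: "p ` X \<subseteq> {..<m}"
      "\<And>x y. x \<in> X \<Longrightarrow> y \<in> X \<Longrightarrow> p x = p y \<Longrightarrow> dist x y < r / 2"
    and lim: "\<And>i. i < m \<Longrightarrow> (\<lambda>n. orbit_sum T (\<lambda>z. of_bool (p z = i)) n x / real n
         - orbit_sum T (\<lambda>z. of_bool (p z = i)) n y / real n) \<longlonglongrightarrow> 0"
    using ex[of "r / 2"] \<open>0 < r\<close> by auto
  define u where "u n = r / 2 + d * (\<Sum>i<m. \<bar>orbit_sum T (\<lambda>z. of_bool (p z = i)) n x / real n
         - orbit_sum T (\<lambda>z. of_bool (p z = i)) n y / real n\<bar>)" for n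
  have "u \<longlonglongrightarrow> r / 2 + d * (\<Sum>i<m. \<bar>0\<bar>)"
    unfolding u_def using lim by (intro tendsto_intros) auto
  then have "eventually (\<lambda>n. u n < r) sequentially"
    by (rule order_tendstoD) (use \<open>0 < r\<close> in simp)
  then have "eventually (\<lambda>n. norm (F_finite T n x y - 0) < r) sequentially"
    using eventually_gt_at_top[of 0]
  proof eventually_elim
    case (elim n)
    have "F_finite T n x y \<le> u n"
      unfolding u_def by (rule F_finite_le_partition[OF T_in xy elim(2) p d])
    then show ?case using elim(1) F_finite_nonneg[of T n x y] by simp
  qed
  then show "\<exists>no. \<forall>n\<ge>no. norm (F_finite T n x y - 0) < r"
    by (simp add: eventually_sequentially)
qed

text \<open>Partitions of mesh 1 / (j + 1) have countably many cells in all, so outside one null set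
  every point visits each cell with frequency equal to its measure. Any two such points share all
  frequencies, which forces F = 0.\<close>

lemma ergodic_imp_AE_N_F:
  assumes erg: "ergodic T M"
  shows "AE w in M \<Otimes>\<^sub>M M. w \<in> N_F X T"
proof -
  have "\<exists>(p :: 'a \<Rightarrow> nat) m. p \<in> M \<rightarrow>\<^sub>M count_space UNIV \<and> p ` X \<subseteq> {..<m} \<and>
      (\<forall>x\<in>X. \<forall>y\<in>X. p x = p y \<longrightarrow> dist x y < 1 / real (Suc j))" for j
    using compact_measurable_small_partition[OF compact_X sets_M, of "1 / real (Suc j)"]
    by (metis of_nat_0_less_iff zero_less_Suc zero_less_divide_1_iff)
  then obtain p :: "nat \<Rightarrow> 'a \<Rightarrow> nat" and m where
    pm [measurable]: "\<And>j. p j \<in> M \<rightarrow>\<^sub>M count_space UNIV" and p: "\<And>j. p j ` X \<subseteq> {..<m j}"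
      "\<And>j. \<forall>x\<in>X. \<forall>y\<in>X. p j x = p j y \<longrightarrow> dist x y < 1 / real (Suc j)"
    by metis
  define G where "G x \<longleftrightarrow> (\<forall>j i. (\<lambda>n. orbit_sum T (\<lambda>z. of_bool (p j z = i)) n x / real n)
      \<longlonglongrightarrow> (\<integral>z. of_bool (p j z = i) \<partial>M))" for x
  have G: "AE x in M. G x"
    unfolding G_def AE_all_countable
    by (intro allI ergodic_average_tendsto[OF _ _ erg, where b = 1]) auto
  have pair: "(x, y) \<in> N_F X T" if "G x" "G y" "x \<in> X" "y \<in> X" for x y
  proof -
    have "(\<lambda>n. F_finite T n x y) \<longlonglongrightarrow> 0"
    proof (rule F_finite_tendsto_0[OF that(3,4)])
      fix e :: real assume "0 < e"
      then obtain j where j: "1 / real (Suc j) < e" using nat_approx_posE by blast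
      have "(\<lambda>n. orbit_sum T (\<lambda>z. of_bool (p j z = i)) n x / real n
         - orbit_sum T (\<lambda>z. of_bool (p j z = i)) n y / real n) \<longlonglongrightarrow> 0" for i
        using tendsto_diff[OF that(1)[unfolded G_def, rule_format, of j i]
            that(2)[unfolded G_def, rule_format, of j i]] by simp
      moreover have "\<forall>x\<in>X. \<forall>y\<in>X. p j x = p j y \<longrightarrow> dist x y < e"
        using p(2)[of j] less_trans[OF _ j] by blast
      ultimately show "\<exists>(p :: 'a \<Rightarrow> nat) m. p ` X \<subseteq> {..<m} \<and>
        (\<forall>x\<in>X. \<forall>y\<in>X. p x = p y \<longrightarrow> dist x y < e) \<and>
        (\<forall>i<m. (\<lambda>n. orbit_sum T (\<lambda>z. of_bool (p z = i)) n x / real n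
           - orbit_sum T (\<lambda>z. of_bool (p z = i)) n y / real n) \<longlonglongrightarrow> 0)"
        using p(1)[of j] by (intro exI[of _ "p j"] exI[of _ "m j"]) simp
    qed
    then have "(\<lambda>n. ereal (F_finite T n x y)) \<longlonglongrightarrow> 0"
      using tendsto_ereal[of _ 0] by (simp add: zero_ereal_def)
    then have "F_upper T x y = 0" "F_lower T x y = 0"
      unfolding F_upper_def F_lower_def by (auto intro!: lim_imp_Limsup lim_imp_Liminf)
    then show ?thesis using that by (simp add: N_F_def F_exists_def F_value_def)
  qed
  show ?thesis
  proof (rule MM.AE_pair_measure)
    show "{w \<in> space (M \<Otimes>\<^sub>M M). w \<in> N_F X T} \<in> sets (M \<Otimes>\<^sub>M M)"
      using N_F_sets by measurable
    show "AE x in M. AE y in M. (x, y) \<in> N_F X T"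
      using G AE_space
    proof eventually_elim
      case x: (elim x)
      show ?case using G AE_space
        by eventually_elim (use x pair space_M in auto)
    qed
  qed
qed

text \<open>Otherwise the maximal lemma yields x with all averages of f at most c and y with all
  averages at least c', where c < c'. The Lipschitz estimate then keeps
  \<open>F_finite T n x y\<close> above (c' - c) / L for n > 0.\<close>

lemma F_lower_0_imp_mean_le:
  assumes ae: "AE x in M. AE y in M. F_lower T x y = 0"
    and lip: "L-lipschitz_on X f" and L: "0 < L"
    and b: "\<And>x. x \<in> space M \<Longrightarrow> \<bar>f x\<bar> \<le> b"
    and A: "A \<in> sets M" "T -` A \<inter> space M = A" "0 < prob A"
    and B: "B \<in> sets M" "T -` B \<inter> space M = B" "0 < prob B"
  shows "(\<integral>x. indicator B x * f x \<partial>M) / prob B \<le> (\<integral>x. indicator A x * f x \<partial>M) / prob A"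
proof (rule ccontr)
  have f [measurable]: "f \<in> borel_measurable M"
    by (rule continuous_on_measurable[OF lipschitz_on_continuous_on[OF lip]])
  assume "\<not> ?thesis"
  then have lt: "(\<integral>x. indicator A x * f x \<partial>M) / prob A
      < (\<integral>x. indicator B x * f x \<partial>M) / prob B"
    by simp
  \<comment> \<open>Two thresholds are chosen because a single one would only bound the lower limit
    below by 0.\<close>
  from dense[OF lt] obtain c where c: "(\<integral>x. indicator A x * f x \<partial>M) / prob A < c"
      "c < (\<integral>x. indicator B x * f x \<partial>M) / prob B"
    by blast
  from dense[OF c(2)] obtain c' where c': "c < c'" "c' < (\<integral>x. indicator B x * f x \<partial>M) / prob B"
    by blast
  have nA: "\<not> (AE x in M. x \<in> A \<longrightarrow> (\<exists>n. real n * c < orbit_sum T f n x))"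
    using maximal_ergodic_lemma_const[OF f b A(1,2), of c] c(1) A(3)
    by (auto simp: pos_divide_less_eq)
  \<comment> \<open>Averages of f that are at least c' correspond to the maximal lemma for -f and
    -c'.\<close>
  have nB: "\<not> (AE y in M. y \<in> B \<longrightarrow> (\<exists>n. real n * (- c') < orbit_sum T (\<lambda>x. - f x) n y))"
  proof
    assume "AE y in M. y \<in> B \<longrightarrow> (\<exists>n. real n * (- c') < orbit_sum T (\<lambda>x. - f x) n y)"
    then have "- c' * prob B \<le> (\<integral>x. indicator B x * - f x \<partial>M)"
      by (intro maximal_ergodic_lemma_const[OF _ _ B(1,2), of _ b]) (use b in auto)
    then show False using c'(2) B(3) by (simp add: pos_less_divide_eq)
  qed
  \<comment> \<open>By Fubini x is chosen first, with almost every y satisfying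
    \<open>F_lower T x y = 0\<close>; y is then found inside this section. Both exist because the
    sets behind \<open>nA\<close> and \<open>nB\<close> are not null.\<close>
  obtain x where x: "x \<in> space M" "AE y in M. F_lower T x y = 0"
      "\<And>n. orbit_sum T f n x \<le> real n * c"
  proof (rule ccontr)
    assume "\<not> thesis"
    with that have no: "\<not> (x \<in> space M \<and> (AE y in M. F_lower T x y = 0) \<and>
        (\<forall>n. orbit_sum T f n x \<le> real n * c))" for x by blast
    have "AE x in M. x \<in> A \<longrightarrow> (\<exists>n. real n * c < orbit_sum T f n x)"
      using ae AE_space by eventually_elim (use no not_le in blast)
    with nA show False by blast
  qed
  obtain y where y: "y \<in> space M" "F_lower T x y = 0" "\<And>n. real n * c' \<le> orbit_sum T f n y"
  proof (rule ccontr)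
    assume "\<not> thesis"
    with that have no: "\<not> (y \<in> space M \<and> F_lower T x y = 0 \<and>
        (\<forall>n. real n * c' \<le> orbit_sum T f n y))" for y by blast
    have "AE y in M. y \<in> B \<longrightarrow> (\<exists>n. real n * (- c') < orbit_sum T (\<lambda>x. - f x) n y)"
      using x(2) AE_space
    proof eventually_elim
      case (elim y)
      then obtain n where "orbit_sum T f n y < real n * c'" using no[of y] not_le by blast
      then show ?case unfolding orbit_sum_minus by (auto intro!: exI[of _ n])
    qed
    with nB show False by blast
  qed
  \<comment> \<open>The index n = 0 is excluded, since division by zero makes
    \<open>F_finite T 0 x y\<close> equal to 0.\<close>
  have "eventually (\<lambda>n. ereal ((c' - c) / L) \<le> ereal (F_finite T n x y)) sequentially"
    using eventually_gt_at_top[of 0]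
  proof eventually_elim
    case (elim n)
    have "real n * (c' - c) \<le> orbit_sum T f n y - orbit_sum T f n x"
      using x(3)[of n] y(3)[of n] by (simp add: algebra_simps)
    then have "c' - c \<le> (orbit_sum T f n y - orbit_sum T f n x) / real n"
      using elim by (simp add: field_simps)
    also have "\<dots> \<le> L * F_finite T n x y"
      using F_finite_ge_orbit_sum_diff[OF lip T_in] x(1) y(1) L by (simp add: space_M)
    finally show ?case using L by (simp add: field_simps)
  qed
  then have "ereal ((c' - c) / L) \<le> F_lower T x y"
    unfolding F_lower_def by (rule Liminf_bounded)
  then have "(c' - c) / L \<le> 0" using y(2) by (simp add: zero_ereal_def)
  then show False using c'(1) L by (simp add: field_simps)
qed

text \<open>By inner regularity an invariant A of measure strictly between 0 and 1 contains a
  compact K of positive measure. Lipschitz functions decreasing to the indicator of K have mean at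
  least prob K / prob A on A, whereas their means on the complement B tend to 0, as K is closed and
  misses B. This contradicts the comparison of means.\<close>

lemma AE_N_F_lower_imp_ergodic:
  assumes ae: "AE w in M \<Otimes>\<^sub>M M. w \<in> N_F_lower X T"
    and reg: "\<And>A. A \<in> sets M \<Longrightarrow> emeasure M A = (SUP K\<in>{K. compact K \<and> K \<subseteq> A}. emeasure M K)"
  shows "ergodic T M"
  unfolding ergodic_def
proof (intro ballI impI, rule ccontr)
  fix A assume A: "A \<in> sets M" "T -` A \<inter> space M = A"
    and not01: "\<not> (emeasure M A = 0 \<or> emeasure M A = 1)"
  define B where "B = space M - A"
  have B: "B \<in> sets M" "T -` B \<inter> space M = B"
    using A T_in_space by (auto simp: B_def)
  have posA: "0 < prob A" using not01 by (auto simp: emeasure_eq_measure zero_less_measure_iff)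
  have "prob A \<noteq> 1" using not01 by (auto simp: emeasure_eq_measure)
  then have posB: "0 < prob B"
    using prob_compl[OF A(1)] prob_le_1[of A] by (simp add: B_def less_le)
  have ae2: "AE x in M. AE y in M. F_lower T x y = 0"
  proof -
    have "AE x in M. AE y in M. (x, y) \<in> N_F_lower X T" using MM.AE_pair[OF ae] .
    then show ?thesis
    proof eventually_elim
      case (elim x)
      then show ?case by eventually_elim (simp add: N_F_lower_def)
    qed
  qed
  have "0 < (SUP K\<in>{K. compact K \<and> K \<subseteq> A}. emeasure M K)"
    using reg[OF A(1)] not01 by (simp add: zero_less_iff_neq_zero)
  then obtain K where K: "compact K" "K \<subseteq> A" "0 < emeasure M K"
    unfolding less_SUP_iff by blast
  have AX: "A \<subseteq> X" using sets.sets_into_space[OF A(1)] by (simp add: space_M)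
  have KM [measurable]: "K \<in> sets M"
    unfolding sets_M sets_restrict_space using K AX compact_imp_closed[OF K(1)]
    by (auto intro!: image_eqI[of _ _ K])
  have posK: "0 < prob K" using K(3) by (simp add: emeasure_eq_measure)
  \<comment> \<open>The distance \<open>infdist\<close> to the empty set is 0 by convention, so
    nonemptiness matters for detecting points outside \<open>K\<close>.\<close>
  have Kne: "K \<noteq> {}" using K(3) by auto
  \<comment> \<open>A tent over \<open>K\<close>: it is 1 on \<open>K\<close> and 0 at distance at
    least 1 / (k + 1), so it shrinks to the indicator of \<open>K\<close> while staying
    Lipschitz.\<close>
  define f where "f k x = max 0 (1 - real (Suc k) * infdist x K)" for k x
  have lip: "(real (Suc k))-lipschitz_on X (f k)" for k
  proof (rule lipschitz_onI)
    fix x y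
    have "\<bar>f k x - f k y\<bar> \<le> \<bar>real (Suc k) * infdist x K - real (Suc k) * infdist y K\<bar>"
      by (simp add: f_def)
    also have "\<dots> = real (Suc k) * \<bar>infdist x K - infdist y K\<bar>"
      by (simp only: right_diff_distrib[symmetric] abs_mult abs_of_nat)
    also have "\<dots> \<le> real (Suc k) * dist x y"
      by (intro mult_left_mono infdist_triangle_abs) auto
    finally show "dist (f k x) (f k y) \<le> real (Suc k) * dist x y" by (simp add: dist_real_def)
  qed simp
  have fb: "\<bar>f k x\<bar> \<le> 1" for k x by (simp add: f_def infdist_nonneg)
  have f [measurable]: "f k \<in> borel_measurable M" for k
    by (rule continuous_on_measurable[OF lipschitz_on_continuous_on[OF lip]])
  have "prob K / prob A \<le> (\<integral>x. indicator B x * f k x \<partial>M) / prob B" for k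
  proof -
    have "prob K = (\<integral>x. indicator K x \<partial>M)" using KM by (simp add: sets.sets_into_space Int_absorb2)
    also have "\<dots> \<le> (\<integral>x. indicator A x * f k x \<partial>M)"
    proof (rule integral_mono)
      show "integrable M (\<lambda>x. indicator K x :: real)"
        by (rule integrable_bounded[of _ 1]) (auto simp: indicator_def)
      show "integrable M (\<lambda>x. indicator A x * f k x)"
        by (rule integrable_bounded[of _ 1]) (use A fb in \<open>auto simp: indicator_def\<close>)
      fix x
      show "indicator K x \<le> indicator A x * f k x"
        using K(2) by (auto simp: indicator_def f_def)
    qed
    finally have "prob K / prob A \<le> (\<integral>x. indicator A x * f k x \<partial>M) / prob A"
      using posA by (simp add: divide_right_mono)
    \<comment> \<open>The comparison of means is used with A and B interchanged.\<close>
    also have "\<dots> \<le> (\<integral>x. indicator B x * f k x \<partial>M) / prob B"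
      by (rule F_lower_0_imp_mean_le[OF ae2 lip _ fb B posB A posA]) simp
    finally show ?thesis .
  qed
  moreover have "(\<lambda>k. (\<integral>x. indicator B x * f k x \<partial>M) / prob B) \<longlonglongrightarrow> 0 / prob B"
  proof (intro tendsto_divide tendsto_const)
    have "(\<lambda>k. \<integral>x. indicator B x * f k x \<partial>M) \<longlonglongrightarrow> (\<integral>x. 0 \<partial>M)"
    proof (rule integral_dominated_convergence[where w = "\<lambda>_. 1"])
      show "AE x in M. (\<lambda>k. indicator B x * f k x) \<longlonglongrightarrow> 0"
      proof (rule AE_I2)
        fix x
        show "(\<lambda>k. indicator B x * f k x) \<longlonglongrightarrow> 0"
        proof (cases "x \<in> B")
          case True
          then have "x \<notin> K" using K(2) by (auto simp: B_def)
          then have "0 < infdist x K"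
            using in_closed_iff_infdist_zero[OF compact_imp_closed[OF K(1)] Kne, of x]
              infdist_nonneg[of x K] by (simp add: less_le)
          then obtain N where N: "1 / real (Suc N) < infdist x K" using nat_approx_posE by blast
          have "f k x = 0" if "k \<ge> N" for k
          proof -
            have "1 < real (Suc N) * infdist x K" using N by (simp add: field_simps)
            also have "\<dots> \<le> real (Suc k) * infdist x K"
              using that infdist_nonneg[of x K] by (intro mult_right_mono) auto
            finally show ?thesis by (simp add: f_def)
          qed
          then show ?thesis
            by (intro tendsto_eventually eventually_sequentiallyI[of N]) simp
        qed simp
      qed
      show "AE x in M. norm (indicator B x * f k x) \<le> 1" for k
        using fb by (intro AE_I2) (auto simp: indicator_def)
    qed (use B in auto)
    then show "(\<lambda>k. \<integral>x. indicator B x * f k x \<partial>M) \<longlonglongrightarrow> 0" by simp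
  qed (use posB in simp)
  ultimately have "prob K / prob A \<le> 0 / prob B"
    by (intro LIMSEQ_le_const) auto
  then show False using posK posA by (simp add: divide_le_0_iff)
qed

end

section \<open>Invariant measures and the equivalence\<close>

lemma compact_metric_system_invariant_measure:
  assumes "compact X" "continuous_on X T" "T \<in> X \<rightarrow> X" "\<mu> \<in> invariant_measures X T"
  shows "compact_metric_system \<mu> T X"
proof -
  have \<mu>: "prob_space \<mu>" "sets \<mu> = sets (restrict_space borel X)"
      "\<And>A. A \<in> sets \<mu> \<Longrightarrow> emeasure \<mu> (T -` A \<inter> space \<mu>) = emeasure \<mu> A"
    using assms(4) by (auto simp: invariant_measures_def)
  have T: "T \<in> \<mu> \<rightarrow>\<^sub>M \<mu>"
    unfolding measurable_cong_sets[OF \<mu>(2) \<mu>(2)]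
    by (intro measurable_restrict_space2 borel_measurable_continuous_on_restrict assms(2))
       (use assms(3) in \<open>simp add: space_restrict_space\<close>)
  have "distr \<mu> \<mu> T = \<mu>"
    by (rule measure_eqI) (use \<mu>(3) T in \<open>simp_all add: emeasure_distr\<close>)
  then show ?thesis
    unfolding compact_metric_system_def measure_preserving_system_def
      compact_metric_system_axioms_def measure_preserving_system_axioms_def
    using \<mu> T assms(1) by blast
qed

theorem theorem5p4:
  fixes X :: "'a::metric_space set" and T :: "'a \<Rightarrow> 'a" and \<mu> :: "'a measure"
  assumes "compact X" and "X \<noteq> {}"
    and "continuous_on X T" and "T \<in> X \<rightarrow> X"
    and "\<mu> \<in> invariant_measures X T"
  shows "(ergodic T \<mu> \<longleftrightarrow> emeasure (\<mu> \<Otimes>\<^sub>M \<mu>) (N_F X T) = 1) \<and>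
         (ergodic T \<mu> \<longleftrightarrow> emeasure (\<mu> \<Otimes>\<^sub>M \<mu>) (N_F_lower X T) = 1)"
proof -
  interpret compact_metric_system \<mu> T X
    using assms by (intro compact_metric_system_invariant_measure)
  have reg: "emeasure \<mu> A = (SUP K\<in>{K. compact K \<and> K \<subseteq> A}. emeasure \<mu> K)" if "A \<in> sets \<mu>" for A
    using assms(5) that unfolding invariant_measures_def regular_measure_def by blast
  \<comment> \<open>The inclusion of \<open>N_F X T\<close> in \<open>N_F_lower X T\<close> closes
    the cycle of implications.\<close>
  have "AE w in \<mu> \<Otimes>\<^sub>M \<mu>. w \<in> N_F_lower X T" if "AE w in \<mu> \<Otimes>\<^sub>M \<mu>. w \<in> N_F X T"
    using that by eventually_elim (use N_F_subset in blast)
  then show ?thesis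
    unfolding emeasure_pair_eq_1_iff[OF N_F_sets] emeasure_pair_eq_1_iff[OF N_F_lower_sets]
    using ergodic_imp_AE_N_F AE_N_F_lower_imp_ergodic[OF _ reg] by blast
qed

end
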